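(* Let $X$ be a random vector in $\mathbb{R}^p$ and $Y$ a random variable with values in $\{1,\dots,G\}$. Put $\pi_g=\Pr(Y=g)>0$ and suppose that, conditionally on $Y=g$, $X$ has density $f_g$ on $\mathbb{R}^p$. Let $\beta$ be a fixed $p\times d$ real matrix of full column rank, $d\le p$, such that $Y$ is conditionally independent of $X$ given $\beta^\top X$ (in the pointwise sense stated in the context). Let $\tilde f_g$ denote the density of $\beta^\top X$ conditionally on $Y=g$. Then for every $x$ in the sample space of $X$: (i) for any two groups $g,k\in\{1,\dots,G\}$ with $f_k(x)\neq 0$, $$\frac{f_g(x)}{f_k(x)}=\frac{\tilde f_g(\beta^\top x)}{\tilde f_k(\beta^\top x)};$$ (ii) the maximum a posteriori cluster assignment is unchanged when it is computed from $\beta^\top x$ instead of $x$, i.e. $$\arg\max_{g}\frac{\pi_g f_g(x)}{\sum_{j=1}^G\pi_j f_j(x)}=\arg\max_{g}\frac{\pi_g \tilde f_g(\beta^\top x)}{\sum_{j=1}^G\pi_j \tilde f_j(\beta^\top x)}$$ (equality of the sets of maximizers over $g\in\{1,\dots,G\}$).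
   Context: $f_X=\sum_{g=1}^G\pi_g f_g$ is the marginal (mixture) density of $X$ and $f_{\beta^\top X}=\sum_{g=1}^G\pi_g\tilde f_g$ is the marginal density of $\beta^\top X$; all densities are with respect to Lebesgue measure, with fixed versions taking values in $[0,\infty)$. The sample space of $X$ is the set of $x\in\mathbb{R}^p$ with $f_X(x)>0$ and $f_{\beta^\top X}(\beta^\top x)>0$. For such $x$ the conditional probabilities are given by Bayes' rule: $\Pr(Y=g\mid X=x)=\pi_g f_g(x)/f_X(x)$ and $\Pr(Y=g\mid \beta^\top X=\beta^\top x)=\pi_g\tilde f_g(\beta^\top x)/f_{\beta^\top X}(\beta^\top x)$. The conditional independence of $Y$ and $X$ given $\beta^\top X$ means that the distribution of $Y\mid X$ is the same as that of $Y\mid\beta^\top X$ for all values of $X$ in its sample space, i.e. $\Pr(Y=g\mid X=x)=\Pr(Y=g\mid\beta^\top X=\beta^\top x)$ for all $g$ and all $x$ in the sample space. The maximum a posteriori (MAP) rule assigns an observation to a cluster for which the conditional probability given the data is maximal. *)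

theory Defs
  imports "HOL-Probability.Probability"
begin

definition cluster_weight :: "'w measure \<Rightarrow> ('w \<Rightarrow> nat) \<Rightarrow> nat \<Rightarrow> real" where
  "cluster_weight M Y g = \<P>(\<omega> in M. Y \<omega> = g)"

text \<open>A density is a real-valued function, that is, a fixed version, and not a class of
  functions modulo null sets.\<close>

definition has_cluster_density ::
  "'w measure \<Rightarrow> ('w \<Rightarrow> nat) \<Rightarrow> nat \<Rightarrow> ('w \<Rightarrow> 'a::euclidean_space) \<Rightarrow> ('a \<Rightarrow> real) \<Rightarrow> bool" where
  "has_cluster_density M Y g Z h \<longleftrightarrow>
     (\<forall>z. 0 \<le> h z) \<and>
     distributed (uniform_measure M {\<omega> \<in> space M. Y \<omega> = g}) lborel Z (\<lambda>z. ennreal (h z))"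

definition mixture_density :: "nat \<Rightarrow> (nat \<Rightarrow> real) \<Rightarrow> (nat \<Rightarrow> 'a \<Rightarrow> real) \<Rightarrow> 'a \<Rightarrow> real" where
  "mixture_density G w h z = (\<Sum>j = 1..G. w j * h j z)"

text \<open>The conditional probability of cluster \<open>g\<close> given the observation \<open>z\<close>, by Bayes' rule;
  meaningful only where the mixture density is positive.\<close>

definition cluster_posterior ::
  "nat \<Rightarrow> (nat \<Rightarrow> real) \<Rightarrow> (nat \<Rightarrow> 'a \<Rightarrow> real) \<Rightarrow> nat \<Rightarrow> 'a \<Rightarrow> real" where
  "cluster_posterior G w h g z = w g * h g z / mixture_density G w h z"

definition sample_space ::
  "nat \<Rightarrow> (nat \<Rightarrow> real) \<Rightarrow> (nat \<Rightarrow> real^'p \<Rightarrow> real) \<Rightarrow> (nat \<Rightarrow> real^'d \<Rightarrow> real) \<Rightarrow>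
   real^'d^'p \<Rightarrow> (real^'p) set" where
  "sample_space G w f ft \<beta> =
     {x. mixture_density G w f x > 0 \<and> mixture_density G w ft (transpose \<beta> *v x) > 0}"

text \<open>Conditional independence of \<open>Y\<close> and \<open>X\<close> given \<open>\<beta>\<^sup>T X\<close>, in the pointwise sense: the law of
  \<open>Y\<close> given \<open>X = x\<close> is that of \<open>Y\<close> given \<open>\<beta>\<^sup>T X = \<beta>\<^sup>T x\<close> for every \<open>x\<close> in the sample space.\<close>

definition cond_indep_given_projection ::
  "nat \<Rightarrow> (nat \<Rightarrow> real) \<Rightarrow> (nat \<Rightarrow> real^'p \<Rightarrow> real) \<Rightarrow> (nat \<Rightarrow> real^'d \<Rightarrow> real) \<Rightarrow>
   real^'d^'p \<Rightarrow> bool" where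
  "cond_indep_given_projection G w f ft \<beta> \<longleftrightarrow>
     (\<forall>g \<in> {1..G}. \<forall>x \<in> sample_space G w f ft \<beta>.
        cluster_posterior G w f g x = cluster_posterior G w ft g (transpose \<beta> *v x))"

definition MAP_clusters ::
  "nat \<Rightarrow> (nat \<Rightarrow> real) \<Rightarrow> (nat \<Rightarrow> 'a \<Rightarrow> real) \<Rightarrow> 'a \<Rightarrow> nat set" where
  "MAP_clusters G w h z =
     {g. is_arg_max (\<lambda>g. cluster_posterior G w h g z) (\<lambda>g. g \<in> {1..G}) g}"

end

theory Submission
  imports Defs
begin

text \<open>Equality of the posteriors at \<open>x\<close> and \<open>\<beta>\<^sup>T x\<close> says that \<open>f\<^sub>g(x)\<close> and the projected density at
  \<open>\<beta>\<^sup>T x\<close> are proportional, with a positive factor (the quotient of the two mixture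
  densities) that does not depend on \<open>g\<close>; it cancels in every ratio.\<close>

theorem mainTheorem1:
  fixes M :: "'w measure"
    and X :: "'w \<Rightarrow> real^'p"
    and Y :: "'w \<Rightarrow> nat"
    and G :: nat
    and w :: "nat \<Rightarrow> real"
    and f :: "nat \<Rightarrow> real^'p \<Rightarrow> real"
    and ft :: "nat \<Rightarrow> real^'d \<Rightarrow> real"
    and \<beta> :: "real^'d^'p"
    and x :: "real^'p"
  assumes "prob_space M"
    and "X \<in> measurable M borel"
    and "Y \<in> measurable M (count_space {1..G})"
    and "\<And>g. g \<in> {1..G} \<Longrightarrow> w g = cluster_weight M Y g"
    and "\<And>g. g \<in> {1..G} \<Longrightarrow> w g > 0"
    and "\<And>g. g \<in> {1..G} \<Longrightarrow> has_cluster_density M Y g X (f g)"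
    and "CARD('d) \<le> CARD('p)"
    and "rank \<beta> = CARD('d)"
    and "\<And>g. g \<in> {1..G} \<Longrightarrow> has_cluster_density M Y g (\<lambda>\<omega>. transpose \<beta> *v X \<omega>) (ft g)"
    and "cond_indep_given_projection G w f ft \<beta>"
    and "x \<in> sample_space G w f ft \<beta>"
  shows "(\<forall>g \<in> {1..G}. \<forall>k \<in> {1..G}. f k x \<noteq> 0 \<longrightarrow>
            f g x / f k x = ft g (transpose \<beta> *v x) / ft k (transpose \<beta> *v x)) \<and>
         MAP_clusters G w f x = MAP_clusters G w ft (transpose \<beta> *v x)"
proof -
  let ?z = "transpose \<beta> *v x"
  define m where "m = mixture_density G w f x"
  define n where "n = mixture_density G w ft ?z"
  have mn: "m > 0" "n > 0"
    using assms(11) by (simp_all add: sample_space_def m_def n_def)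
  have post: "cluster_posterior G w f g x = cluster_posterior G w ft g ?z"
    if "g \<in> {1..G}" for g
    using assms(10,11) that unfolding cond_indep_given_projection_def by blast
  \<comment> \<open>Both sides of \<open>post\<close> carry the same weight \<open>w g\<close>,
    which is positive and hence cancels.\<close>
  have scaled: "f g x = (m / n) * ft g ?z" if "g \<in> {1..G}" for g
    using post[OF that] assms(5)[OF that] mn
    unfolding cluster_posterior_def m_def[symmetric] n_def[symmetric]
    by (simp add: field_simps)
  \<comment> \<open>Since \<open>m / n\<close> is nonzero, the two denominators vanish together; in
    that case both quotients are 0 by the convention on division by zero.\<close>
  have "f g x / f k x = ft g ?z / ft k ?z" if "g \<in> {1..G}" "k \<in> {1..G}" for g k
    using scaled[OF that(1)] scaled[OF that(2)] mn by simp
  \<comment> \<open>\<open>is_arg_max\<close> compares values only at indices in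
    \<open>{1..G}\<close>, where \<open>post\<close> makes the two objectives equal.\<close>
  moreover have "MAP_clusters G w f x = MAP_clusters G w ft ?z"
    using post by (auto simp: MAP_clusters_def is_arg_max_def)
  ultimately show ?thesis by blast
qed

end
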